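(* Consider quadratic regression with a standard normal covariate, i.e. $f_X(x)=\frac{1}{\sqrt{2\pi}}e^{-x^2/2}$. For any subsampling proportion $\alpha\in(0,1)$, the $D$-optimal subsampling design $\xi^*$ of mass $\alpha$ has density $$f_{\xi^*}(x)=f_X(x)\,\mathbf{1}_{(-\infty,-a]\cup[-b,b]\cup[a,\infty)}(x)$$ for some real numbers $a>b>0$.
   Context: Quadratic regression: $\mathbf{f}(x)=(1,x,x^2)^\top$. A (continuous) subsampling design $\xi$ of mass $\alpha$ is a measure on $\mathbb{R}$ with Lebesgue density $f_\xi$ satisfying $0\le f_\xi(x)\le f_X(x)$ for all $x$ and $\int f_\xi(x)\,dx=\alpha$ (densities are understood up to Lebesgue null sets). Its information matrix is $\mathbf{M}(\xi)=\int \mathbf{f}(x)\mathbf{f}(x)^\top f_\xi(x)\,dx$. The $D$-optimal subsampling design is the one maximizing $\log\det\mathbf{M}(\xi)$ among all subsampling designs $\xi$ of mass $\alpha$. $\mathbf{1}_A$ is the indicator function of $A$. *)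

theory Defs
  imports "HOL-Probability.Probability"
begin

definition quad_regressors :: "real \<Rightarrow> real ^ 3" where
  "quad_regressors x = vector [1, x, x\<^sup>2]"

text \<open>A design is a measure, so densities that agree almost everywhere give the same design.
  Borel densities suffice: a Lebesgue-measurable one has a Borel version obeying the same bounds.\<close>

definition subsampling_density :: "(real \<Rightarrow> real) \<Rightarrow> real \<Rightarrow> (real \<Rightarrow> real) \<Rightarrow> bool" where
  "subsampling_density fX \<alpha> f \<longleftrightarrow>
     f \<in> borel_measurable borel \<and> (\<forall>x. 0 \<le> f x \<and> f x \<le> fX x) \<and>
     has_bochner_integral lborel f \<alpha>"

definition subsampling_design :: "(real \<Rightarrow> real) \<Rightarrow> real \<Rightarrow> real measure \<Rightarrow> bool" where
  "subsampling_design fX \<alpha> \<xi> \<longleftrightarrow>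
     (\<exists>f. subsampling_density fX \<alpha> f \<and> \<xi> = density lborel (\<lambda>x. ennreal (f x)))"

text \<open>Integration is with respect to \<open>\<xi>\<close> itself; the lemma below rewrites the entries as
  Lebesgue integrals against a density of \<open>\<xi>\<close>.\<close>

definition info_matrix :: "real measure \<Rightarrow> real ^ 3 ^ 3" where
  "info_matrix \<xi> = (\<chi> i j. LINT x|\<xi>. quad_regressors x $ i * quad_regressors x $ j)"

lemma quad_regressors_nth_measurable [measurable]:
  "(\<lambda>x. quad_regressors x $ i) \<in> borel_measurable borel"
  using exhaust_3[of i] by (auto simp: quad_regressors_def vector_3)

lemma info_matrix_density:
  assumes "subsampling_density fX \<alpha> f"
  shows "info_matrix (density lborel (\<lambda>x. ennreal (f x))) =
    (\<chi> i j. LINT x|lborel. quad_regressors x $ i * quad_regressors x $ j * f x)"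
  using assms unfolding info_matrix_def subsampling_density_def
  by (simp add: integral_density mult.commute)

text \<open>Since HOL sets \<open>ln 0 = 0\<close>, the criterion is extended-real valued, with the value
  \<open>-\<infinity>\<close> at singular information matrices.\<close>

definition D_criterion :: "real measure \<Rightarrow> ereal" where
  "D_criterion \<xi> =
     (if det (info_matrix \<xi>) > 0 then ereal (ln (det (info_matrix \<xi>))) else -\<infinity>)"

definition D_optimal :: "(real \<Rightarrow> real) \<Rightarrow> real \<Rightarrow> real measure \<Rightarrow> bool" where
  "D_optimal fX \<alpha> \<xi> \<longleftrightarrow>
     subsampling_design fX \<alpha> \<xi> \<and>
     (\<forall>\<eta>. subsampling_design fX \<alpha> \<eta> \<longrightarrow> D_criterion \<eta> \<le> D_criterion \<xi>)"

end

theory Submission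
  imports Defs
begin

text \<open>Write \<open>m\<^sub>k\<close> for the moments of a density of mass \<open>\<alpha>\<close>. The Cauchy--Schwarz inequality
  gives \<open>det M \<le> m\<^sub>2 (\<alpha> m\<^sub>4 - m\<^sub>2\<^sup>2)\<close>, with equality for even densities, so only \<open>m\<^sub>2\<close> and
  \<open>m\<^sub>4\<close> matter. Along the three-piece densities of mass \<open>\<alpha>\<close>, the moments are explicit in \<open>a\<close>
  and \<open>b\<close>, and an intermediate value argument from \<open>b = 0\<close> (where the sign comes from the Mills
  ratio bound) to large \<open>a\<close> yields a member satisfying the equivalence-theorem condition
  \<open>\<alpha> (a\<^sup>2 + b\<^sup>2) m\<^sub>2 + \<alpha> m\<^sub>4 = 3 m\<^sub>2\<^sup>2\<close>. For it, the difference to any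
  competitor has the same sign as \<open>(x\<^sup>2 - a\<^sup>2) (x\<^sup>2 - b\<^sup>2)\<close>, and integrating the product bounds
  the competitor's \<open>m\<^sub>4\<close> linearly by its \<open>m\<^sub>2\<close>, which leaves a cubic in \<open>m\<^sub>2\<close> to maximize.\<close>

section \<open>Moments of subsampling densities\<close>

definition moment :: "(real \<Rightarrow> real) \<Rightarrow> nat \<Rightarrow> real" where
  "moment f k = (LINT x|lborel. x ^ k * f x)"

text \<open>A zero integral would force the product to vanish almost everywhere. The zeros of
  \<open>p\<close> form a null set, so \<open>f\<close> itself would vanish almost
  everywhere.\<close>

lemma integral_mult_pos:
  fixes f p :: "real \<Rightarrow> real"
  assumes "integrable lborel (\<lambda>x. p x * f x)" "\<And>x. 0 \<le> f x" "\<And>x. 0 \<le> p x"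
    and "finite {x. p x = 0}" "(LINT x|lborel. f x) \<noteq> 0"
  shows "0 < (LINT x|lborel. p x * f x)"
proof -
  have "(LINT x|lborel. p x * f x) \<noteq> 0"
  proof
    assume "(LINT x|lborel. p x * f x) = 0"
    then have "AE x in lborel. p x * f x = 0"
      using assms by (subst (asm) integral_nonneg_eq_0_iff_AE) auto
    moreover have "AE x in lborel. x \<notin> {x. p x = 0}"
      by (intro AE_not_in finite_imp_null_set_lborel assms)
    ultimately have "AE x in lborel. f x = 0"
      by eventually_elim auto
    then have "(LINT x|lborel. f x) = 0"
      by (rule integral_eq_zero_AE)
    with assms show False by simp
  qed
  moreover have "0 \<le> (LINT x|lborel. p x * f x)"
    using assms by (intro Bochner_Integration.integral_nonneg) auto
  ultimately show ?thesis by simp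
qed

lemma integrable_power_std_normal:
  "integrable lborel (\<lambda>x. x ^ k * std_normal_density x)"
  using integrable_std_normal_moment[of k] by (simp add: mult.commute)

lemma moment_std_normal:
  "moment std_normal_density 0 = 1" "moment std_normal_density 2 = 1"
  "moment std_normal_density 4 = 3"
  using integral_std_normal_moment_even[of 0] integral_std_normal_moment_even[of 1]
    integral_std_normal_moment_even[of 2]
  by (simp_all add: moment_def mult.commute fact_numeral)

lemma integrable_power_subsampling:
  assumes "subsampling_density std_normal_density \<alpha> f"
  shows "integrable lborel (\<lambda>x. x ^ k * f x)"
proof (rule Bochner_Integration.integrable_bound[OF integrable_power_std_normal[of k]])
  show "(\<lambda>x. x ^ k * f x) \<in> borel_measurable lborel"
    using assms unfolding subsampling_density_def by (measurable; simp)
  have f: "0 \<le> f x" "f x \<le> std_normal_density x" for x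
    using assms by (auto simp: subsampling_density_def)
  show "AE x in lborel. norm (x ^ k * f x) \<le> norm (x ^ k * std_normal_density x)"
    using f by (intro AE_I2) (auto simp: abs_mult intro!: mult_left_mono)
qed

lemma moment_0_subsampling:
  assumes "subsampling_density fX \<alpha> f"
  shows "moment f 0 = \<alpha>"
  using assms by (auto simp: subsampling_density_def moment_def has_bochner_integral_iff)

lemma moment_2_pos:
  assumes f: "subsampling_density std_normal_density \<alpha> f" and "0 < \<alpha>"
  shows "0 < moment f 2"
  unfolding moment_def using moment_0_subsampling[OF f] integrable_power_subsampling[OF f] assms
  by (intro integral_mult_pos) (auto simp: moment_def subsampling_density_def)

text \<open>Integrating \<open>(\<alpha> * x\<^sup>2 - m)\<^sup>2\<close> against \<open>f\<close>
  gives \<open>\<alpha>\<close> times the gap. The polynomial has at most two zeros, which makes the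
  inequality strict.\<close>

lemma moment_Cauchy_Schwarz_strict:
  assumes f: "subsampling_density std_normal_density \<alpha> f" and \<alpha>: "0 < \<alpha>"
  shows "(moment f 2)\<^sup>2 < \<alpha> * moment f 4"
proof -
  note int = integrable_power_subsampling[OF f]
  define m where "m = moment f 2"
  define p :: "real \<Rightarrow> real" where "p x = (\<alpha> * x\<^sup>2 - m)\<^sup>2" for x
  have p: "p x * f x = \<alpha>\<^sup>2 * (x ^ 4 * f x) - 2 * \<alpha> * m * (x ^ 2 * f x) + m\<^sup>2 * (x ^ 0 * f x)" for x
    by (simp add: p_def power2_eq_square power4_eq_xxxx algebra_simps)
  have "{x. p x = 0} \<subseteq> {sqrt (m / \<alpha>), - sqrt (m / \<alpha>)}"
  proof
    fix x assume "x \<in> {x. p x = 0}"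
    then have "x\<^sup>2 = m / \<alpha>" using \<alpha> by (simp add: p_def field_simps)
    then have "sqrt (m / \<alpha>) = \<bar>x\<bar>" by (metis real_sqrt_abs)
    then show "x \<in> {sqrt (m / \<alpha>), - sqrt (m / \<alpha>)}" by auto
  qed
  then have "finite {x. p x = 0}" by (rule finite_subset) simp
  moreover have "integrable lborel (\<lambda>x. p x * f x)"
    unfolding p
    by (intro Bochner_Integration.integrable_add Bochner_Integration.integrable_diff
        integrable_mult_right int)
  ultimately have "0 < (LINT x|lborel. p x * f x)"
    using f moment_0_subsampling[OF f] \<alpha>
    by (intro integral_mult_pos) (auto simp: moment_def subsampling_density_def p_def)
  also have "(LINT x|lborel. p x * f x) = \<alpha>\<^sup>2 * moment f 4 - 2 * \<alpha> * m * moment f 2 + m\<^sup>2 * moment f 0"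
    unfolding p moment_def using int[of 0] int[of 2] int[of 4] by simp
  also have "\<dots> = \<alpha> * (\<alpha> * moment f 4 - (moment f 2)\<^sup>2)"
    unfolding moment_0_subsampling[OF f] m_def by (simp add: power2_eq_square algebra_simps)
  finally show ?thesis using \<alpha> by (simp add: zero_less_mult_iff)
qed

section \<open>The determinant of the information matrix\<close>

text \<open>The matrix is the Hankel matrix of the moments of order 0 to 4. The expansion is grouped
  so that every term with an odd moment lies in the last bracket.\<close>

lemma det_info_matrix_density:
  assumes f: "subsampling_density fX \<alpha> f"
  shows "det (info_matrix (density lborel (\<lambda>x. ennreal (f x)))) =
    moment f 2 * (\<alpha> * moment f 4 - (moment f 2)\<^sup>2)
    - (\<alpha> * (moment f 3)\<^sup>2 - 2 * moment f 1 * moment f 2 * moment f 3 + (moment f 1)\<^sup>2 * moment f 4)"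
proof -
  have e: "quad_regressors x $ 1 = x ^ 0" "quad_regressors x $ 2 = x ^ 1"
    "quad_regressors x $ 3 = x ^ 2" for x
    by (simp_all add: quad_regressors_def vector_3)
  show ?thesis
    unfolding info_matrix_density[OF f] det_3 vec_lambda_beta e power_add[symmetric]
      moment_def[symmetric]
    using moment_0_subsampling[OF f]
    by (simp add: power2_eq_square algebra_simps numeral_eq_Suc)
qed

text \<open>The odd-moment bracket is a quadratic form in the first and third moments. Completing
  the square shows that it is nonnegative, by the Cauchy-Schwarz gap.\<close>

lemma det_info_matrix_le:
  assumes f: "subsampling_density std_normal_density \<alpha> f" and \<alpha>: "0 < \<alpha>"
  shows "det (info_matrix (density lborel (\<lambda>x. ennreal (f x)))) \<le>
    moment f 2 * (\<alpha> * moment f 4 - (moment f 2)\<^sup>2)"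
proof -
  let ?q = "\<alpha> * (moment f 3)\<^sup>2 - 2 * moment f 1 * moment f 2 * moment f 3 + (moment f 1)\<^sup>2 * moment f 4"
  have "\<alpha> * ?q = (\<alpha> * moment f 3 - moment f 1 * moment f 2)\<^sup>2
      + (moment f 1)\<^sup>2 * (\<alpha> * moment f 4 - (moment f 2)\<^sup>2)"
    by (simp add: power2_eq_square algebra_simps)
  also have "\<dots> \<ge> 0"
    using moment_Cauchy_Schwarz_strict[OF assms] by simp
  finally have "0 \<le> ?q" using \<alpha> by (simp add: zero_le_mult_iff)
  then show ?thesis unfolding det_info_matrix_density[OF f] by simp
qed

section \<open>Truncated moments and tail bounds of the standard normal law\<close>

text \<open>For nonnegative \<open>t\<close> this is 2 Phi(t) - 1, where Phi is the standard normal
  distribution function.\<close>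

definition central_prob :: "real \<Rightarrow> real" where
  "central_prob t = (LINT x|lborel. std_normal_density x * indicator {-t..t} x)"

lemma DERIV_std_normal_density:
  "(std_normal_density has_real_derivative - x * std_normal_density x) (at x)"
  unfolding std_normal_density_def[abs_def] by (auto intro!: derivative_eq_intros simp: field_simps)

lemma std_normal_density_minus: "std_normal_density (- x) = std_normal_density x"
  by (simp add: std_normal_density_def)

lemma isCont_std_normal_density: "isCont std_normal_density x"
  using DERIV_std_normal_density DERIV_isCont by blast

text \<open>Integration by parts: \<open>x\<^sup>2 - 1\<close> times the density is the derivative
  of \<open>- x\<close> times the density.\<close>

lemma central_moment_2:
  assumes "0 \<le> t"
  shows "(LINT x|lborel. x\<^sup>2 * std_normal_density x * indicator {-t..t} x) =
    central_prob t - 2 * t * std_normal_density t"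
proof -
  have "(LINT x|lborel. (x\<^sup>2 * std_normal_density x - std_normal_density x) * indicator {-t..t} x)
     = - t * std_normal_density t - (- (-t) * std_normal_density (-t))"
    using assms
    by (intro integral_FTC_Icc_real)
      (auto intro!: derivative_eq_intros DERIV_std_normal_density continuous_intros isCont_std_normal_density
          simp: power2_eq_square algebra_simps)
  moreover have "integrable lborel (\<lambda>x. x^k * std_normal_density x * indicator {-t..t} x)" for k
    using integrable_power_std_normal[of k] by (intro integrable_real_mult_indicator) auto
  note this[of 2] this[of 0]
  ultimately show ?thesis by (simp add: central_prob_def std_normal_density_minus left_diff_distrib)
qed

text \<open>The same device with \<open>- x ^ 3\<close> times the density reduces the fourth moment
  to the second.\<close>

lemma central_moment_4:
  assumes "0 \<le> t"
  shows "(LINT x|lborel. x ^ 4 * std_normal_density x * indicator {-t..t} x) =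
    3 * (central_prob t - 2 * t * std_normal_density t) - 2 * t ^ 3 * std_normal_density t"
proof -
  have "(LINT x|lborel. (x ^ 4 * std_normal_density x - 3 * (x\<^sup>2 * std_normal_density x)) * indicator {-t..t} x)
     = - (t^3 * std_normal_density t) - (- ((-t)^3 * std_normal_density (-t)))"
    using assms
    by (intro integral_FTC_Icc_real)
      (auto intro!: derivative_eq_intros DERIV_std_normal_density continuous_intros isCont_std_normal_density
          simp: power2_eq_square power3_eq_cube power4_eq_xxxx algebra_simps)
  moreover have "integrable lborel (\<lambda>x. x^k * std_normal_density x * indicator {-t..t} x)" for k
    using integrable_power_std_normal[of k] by (intro integrable_real_mult_indicator) auto
  note this[of 2] this[of 4]
  ultimately show ?thesis unfolding central_moment_2[OF assms, symmetric]
    by (simp add: std_normal_density_minus left_diff_distrib mult.assoc)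
      (simp add: mult.commute[of "std_normal_density t"])
qed

text \<open>A global antiderivative yields both the derivative on the positive axis and continuity
  up to 0.\<close>

lemma central_prob_antiderivative:
  obtains F where "\<And>x. (F has_real_derivative std_normal_density x) (at x)"
    "\<And>t. 0 \<le> t \<Longrightarrow> central_prob t = F t - F (- t)"
proof -
  obtain F where F: "\<And>x. (F has_vector_derivative std_normal_density x) (at x)"
    using einterval_antiderivative[of "-\<infinity>" \<infinity> std_normal_density] isCont_std_normal_density
    by auto
  then have D: "\<And>x. (F has_real_derivative std_normal_density x) (at x)"
    by (simp add: has_real_derivative_iff_has_vector_derivative)
  have "central_prob t = F t - F (- t)" if "0 \<le> t" for t
    unfolding central_prob_def using that
    by (intro integral_FTC_Icc_real D isCont_std_normal_density) auto
  with D show thesis by (rule that)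
qed

lemma DERIV_central_prob:
  assumes "0 < t"
  shows "(central_prob has_real_derivative 2 * std_normal_density t) (at t)"
proof -
  obtain F where F: "\<And>x. (F has_real_derivative std_normal_density x) (at x)"
    "\<And>t. 0 \<le> t \<Longrightarrow> central_prob t = F t - F (- t)"
    using central_prob_antiderivative by blast
  have "((\<lambda>t. F t - F (- t)) has_real_derivative 2 * std_normal_density t) (at t)"
    by (auto intro!: derivative_eq_intros F(1) DERIV_chain2[OF F(1)] simp: std_normal_density_minus)
  then show ?thesis
    by (rule has_field_derivative_transform_within_open[where S = "{0<..}"]) (use assms F(2) in auto)
qed

lemma continuous_on_central_prob: "continuous_on {0..} central_prob"
proof -
  obtain F where F: "\<And>x. (F has_real_derivative std_normal_density x) (at x)"
    "\<And>t. 0 \<le> t \<Longrightarrow> central_prob t = F t - F (- t)"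
    using central_prob_antiderivative by blast
  have F_cont: "continuous_on UNIV F"
    using F(1) DERIV_isCont by (auto simp: continuous_on_eq_continuous_at)
  have "continuous_on {0..} (\<lambda>t. F t - F (- t))"
    by (intro continuous_intros continuous_on_compose2[OF F_cont]) auto
  then show ?thesis using F(2) by (simp cong: continuous_on_cong_simp)
qed

lemma central_prob_0: "central_prob 0 = 0"
proof -
  have "AE x in lborel. x \<noteq> (0::real)" by (rule AE_lborel_singleton)
  then have "AE x in lborel. std_normal_density x * indicator {-0..0} x = 0"
    by eventually_elim auto
  then show ?thesis unfolding central_prob_def by (rule integral_eq_zero_AE)
qed

lemma central_prob_strict_mono:
  assumes "0 \<le> s" "s < t"
  shows "central_prob s < central_prob t"
\<comment> \<open>The derivative is required only in the interior. This admits \<open>s = 0\<close>,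
  where \<open>central_prob\<close> has a kink because it is 0 on the negative axis.\<close>
proof (rule DERIV_pos_imp_increasing_open[OF \<open>s < t\<close>])
  show "\<exists>y. (central_prob has_real_derivative y) (at x) \<and> 0 < y" if "s < x" "x < t" for x
    using that assms DERIV_central_prob[of x] normal_density_pos[of 1 0 x] by fastforce
  show "continuous_on {s..t} central_prob"
    using assms by (intro continuous_on_subset[OF continuous_on_central_prob]) auto
qed

text \<open>Chebyshev's inequality for a variable of second moment 1.\<close>

lemma central_prob_tail_bound:
  assumes "0 < t"
  shows "1 - central_prob t \<le> 1 / t\<^sup>2"
proof -
  note int = integrable_power_std_normal[of 0] integrable_power_std_normal[of 2]
  have i: "integrable lborel (\<lambda>x. std_normal_density x * indicator {-t..t} x)"
    using int(1) by (intro integrable_real_mult_indicator) auto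
  have "t\<^sup>2 * (1 - central_prob t) =
      (LINT x|lborel. t\<^sup>2 * (std_normal_density x - std_normal_density x * indicator {-t..t} x))"
    using i int(1) moment_std_normal(1) by (simp add: central_prob_def moment_def)
  also have "\<dots> \<le> (LINT x|lborel. x\<^sup>2 * std_normal_density x)"
  proof (rule integral_mono)
    show "integrable lborel (\<lambda>x. t\<^sup>2 * (std_normal_density x - std_normal_density x * indicator {-t..t} x))"
      using i int(1) by simp
    show "integrable lborel (\<lambda>x. x\<^sup>2 * std_normal_density x)" by (rule int(2))
    show "t\<^sup>2 * (std_normal_density x - std_normal_density x * indicator {-t..t} x)
        \<le> x\<^sup>2 * std_normal_density x" for x
    proof (cases "x \<in> {-t..t}")
      case False
      then have "t \<le> \<bar>x\<bar>" by auto
      then have "t\<^sup>2 \<le> x\<^sup>2" using assms by (simp add: abs_le_square_iff[symmetric])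
      then show ?thesis using False by (simp add: mult_right_mono)
    qed simp
  qed
  also have "\<dots> = 1" using moment_std_normal(2) by (simp add: moment_def)
  finally show ?thesis using assms by (simp add: field_simps)
qed

lemma central_prob_less_1:
  assumes "0 \<le> t"
  shows "central_prob t < 1"
proof -
  have "central_prob (t + 1) \<le> (LINT x|lborel. std_normal_density x)"
    unfolding central_prob_def using integrable_power_std_normal[of 0]
    by (intro integral_mono integrable_real_mult_indicator) (auto split: split_indicator)
  also have "\<dots> = 1" using moment_std_normal(1) by (simp add: moment_def)
  finally show ?thesis using central_prob_strict_mono[of t "t + 1"] assms by simp
qed

text \<open>The difference of the two sides is antitone with a nonnegative limit at infinity.\<close>

lemma Mills_ratio_le:
  assumes "0 < a"
  shows "a * (1 - central_prob a) \<le> 2 * std_normal_density a"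
proof (rule field_le_epsilon)
  fix e :: real assume "0 < e"
  let ?h = "\<lambda>t. 2 * std_normal_density t - t * (1 - central_prob t)"
  \<comment> \<open>At this \<open>t\<close> the Chebyshev bound gives
    \<open>?h t \<ge> - 1 / t \<ge> - e\<close>, which replaces the passage to the limit.\<close>
  define t where "t = max a (1 / e)"
  have t: "0 < t" "a \<le> t" "1 / t \<le> e"
    using assms \<open>0 < e\<close> by (auto simp: t_def field_simps max_def)
  have "?h t \<le> ?h a"
  proof (rule DERIV_nonpos_imp_nonincreasing[OF t(2)])
    fix x assume x: "a \<le> x" "x \<le> t"
    with assms have "0 < x" by simp
    \<comment> \<open>The two terms containing the density cancel, leaving only the negated tail
      probability.\<close>
    then have "(?h has_real_derivative - (1 - central_prob x)) (at x)"
      by (auto intro!: derivative_eq_intros DERIV_std_normal_density DERIV_central_prob)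
    moreover have "- (1 - central_prob x) \<le> 0"
      using central_prob_less_1[of x] \<open>0 < x\<close> by simp
    ultimately show "\<exists>y. (?h has_real_derivative y) (at x) \<and> y \<le> 0" by blast
  qed
  moreover have "t * (1 - central_prob t) \<le> 1 / t"
    using central_prob_tail_bound[OF t(1)] t(1)
    by (simp add: field_simps power2_eq_square)
  moreover have "0 \<le> std_normal_density t" by simp
  ultimately show "a * (1 - central_prob a) \<le> 2 * std_normal_density a + e"
    using t(3) by linarith
qed

section \<open>Three-piece densities and their moments\<close>

definition three_piece_density :: "real \<Rightarrow> real \<Rightarrow> real \<Rightarrow> real" where
  "three_piece_density a b x = std_normal_density x * indicator ({..-a} \<union> {-b..b} \<union> {a..}) x"

text \<open>The support indicator is 1 minus that of \<open>{-a..a}\<close> plus that of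
  \<open>{-b..b}\<close>, except at the two points \<open>a\<close> and \<open>-a\<close>. The case
  \<open>b = 0\<close> is included because the later intermediate value argument starts
  there.\<close>

lemma moment_three_piece:
  assumes "0 \<le> b" "b < a"
  shows "moment (three_piece_density a b) k = moment std_normal_density k
    - (LINT x|lborel. x ^ k * std_normal_density x * indicator {-a..a} x)
    + (LINT x|lborel. x ^ k * std_normal_density x * indicator {-b..b} x)"
proof -
  let ?p = "\<lambda>x. x ^ k * std_normal_density x"
  note int = integrable_power_std_normal[of k]
  have i: "integrable lborel (\<lambda>x. ?p x * indicator {-t..t} x)" for t
    using int by (intro integrable_real_mult_indicator) auto
  have "moment (three_piece_density a b) k =
      (LINT x|lborel. ?p x - ?p x * indicator {-a..a} x + ?p x * indicator {-b..b} x)"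
    unfolding moment_def
  proof (rule integral_cong_AE)
    have "AE x in lborel. x \<notin> {a, -a}"
      by (intro AE_not_in finite_imp_null_set_lborel) simp
    then show "AE x in lborel. x ^ k * three_piece_density a b x =
        ?p x - ?p x * indicator {-a..a} x + ?p x * indicator {-b..b} x"
      by eventually_elim (use assms in \<open>auto simp: three_piece_density_def split: split_indicator\<close>)
  qed (unfold three_piece_density_def, measurable)
  also have "\<dots> = moment std_normal_density k - (LINT x|lborel. ?p x * indicator {-a..a} x)
      + (LINT x|lborel. ?p x * indicator {-b..b} x)"
    unfolding moment_def using int i[of a] i[of b] by simp
  finally show ?thesis .
qed

lemma subsampling_three_piece:
  assumes "0 \<le> b" "b < a" and "central_prob b + 1 - central_prob a = \<alpha>"
  shows "subsampling_density std_normal_density \<alpha> (three_piece_density a b)"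
proof -
  have "integrable lborel (three_piece_density a b)"
    unfolding three_piece_density_def using integrable_power_std_normal[of 0]
    by (intro integrable_real_mult_indicator) auto
  then show ?thesis
    using moment_three_piece[OF assms(1,2), of 0] assms(3) moment_std_normal(1)
    by (auto simp: subsampling_density_def three_piece_density_def[abs_def] moment_def central_prob_def
        has_bochner_integral_iff split: split_indicator)
qed

lemma moment_2_three_piece:
  assumes "0 \<le> b" "b < a" "central_prob b + 1 - central_prob a = \<alpha>"
  shows "moment (three_piece_density a b) 2 =
    \<alpha> - 2 * b * std_normal_density b + 2 * a * std_normal_density a"
  using assms by (simp add: moment_three_piece moment_std_normal central_moment_2)

lemma moment_4_three_piece:
  assumes "0 \<le> b" "b < a" "central_prob b + 1 - central_prob a = \<alpha>"
  shows "moment (three_piece_density a b) 4 =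
    3 * (\<alpha> - 2 * b * std_normal_density b + 2 * a * std_normal_density a)
    - 2 * b ^ 3 * std_normal_density b + 2 * a ^ 3 * std_normal_density a"
  using assms by (simp add: moment_three_piece moment_std_normal central_moment_4)

lemma moment_odd_three_piece:
  assumes "odd k"
  shows "moment (three_piece_density a b) k = 0"
proof -
  have "three_piece_density a b (- x) = three_piece_density a b x" for x
    by (auto simp: three_piece_density_def std_normal_density_minus split: split_indicator)
  then have "moment (three_piece_density a b) k = - moment (three_piece_density a b) k"
    using lborel_integral_real_affine[of "-1" "\<lambda>x. x ^ k * three_piece_density a b x" 0] assms
    by (simp add: moment_def)
  then show ?thesis by simp
qed

lemma moment_2_le_1:
  assumes f: "subsampling_density std_normal_density \<alpha> f"
  shows "moment f 2 \<le> 1"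
proof -
  have "moment f 2 \<le> moment std_normal_density 2"
    unfolding moment_def using f
    by (intro integral_mono integrable_power_subsampling[OF f] integrable_power_std_normal)
      (auto simp: subsampling_density_def mult_left_mono)
  then show ?thesis by (simp add: moment_std_normal)
qed

section \<open>Optimality and uniqueness of a stationary three-piece density\<close>

lemma det_three_piece:
  assumes g: "subsampling_density std_normal_density \<alpha> (three_piece_density a b)"
  shows "det (info_matrix (density lborel (\<lambda>x. ennreal (three_piece_density a b x)))) =
    moment (three_piece_density a b) 2 *
    (\<alpha> * moment (three_piece_density a b) 4 - (moment (three_piece_density a b) 2)\<^sup>2)"
  unfolding det_info_matrix_density[OF g] by (simp add: moment_odd_three_piece)

text \<open>The hypothesis \<open>stationary\<close> says that the sensitivity function
  \<open>f(x)\<^sup>T M\<^sup>-\<^sup>1 f(x)\<close> takes the same value at \<open>a\<close> and at \<open>b\<close>;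
  up to an additive and a positive multiplicative constant it is then
  \<open>(x\<^sup>2 - a\<^sup>2) * (x\<^sup>2 - b\<^sup>2)\<close>.\<close>

lemma three_piece_optimal:
  fixes a b \<alpha> :: real
  defines "g \<equiv> three_piece_density a b"
  assumes \<alpha>: "0 < \<alpha>" and b: "0 < b" and ba: "b < a"
    and f: "subsampling_density std_normal_density \<alpha> f"
    and g: "subsampling_density std_normal_density \<alpha> g"
    and stationary: "\<alpha> * (a\<^sup>2 + b\<^sup>2) * moment g 2 + \<alpha> * moment g 4 = 3 * (moment g 2)\<^sup>2"
  shows "det (info_matrix (density lborel (\<lambda>x. ennreal (f x))))
      \<le> det (info_matrix (density lborel (\<lambda>x. ennreal (g x))))"
    and "det (info_matrix (density lborel (\<lambda>x. ennreal (f x))))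
      = det (info_matrix (density lborel (\<lambda>x. ennreal (g x)))) \<Longrightarrow> AE x in lborel. f x = g x"
proof -
  define s M2 M4 m2 m4 where defs: "s = a\<^sup>2 + b\<^sup>2" "M2 = moment g 2" "M4 = moment g 4"
    "m2 = moment f 2" "m4 = moment f 4"
  define w :: "real \<Rightarrow> real" where "w x = (x\<^sup>2 - a\<^sup>2) * (x\<^sup>2 - b\<^sup>2)" for x
  note fi = integrable_power_subsampling[OF f]
  note gi = integrable_power_subsampling[OF g]
  have w: "w x * (g x - f x) = (x ^ 4 * g x - x ^ 4 * f x) - s * (x ^ 2 * g x - x ^ 2 * f x)
      + a\<^sup>2 * b\<^sup>2 * (x ^ 0 * g x - x ^ 0 * f x)" for x
    by (simp add: w_def defs power2_eq_square power4_eq_xxxx algebra_simps)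
  have w_int: "integrable lborel (\<lambda>x. w x * (g x - f x))"
    unfolding w
    by (intro Bochner_Integration.integrable_add Bochner_Integration.integrable_diff
        integrable_mult_right fi gi)
  have "(LINT x|lborel. w x * (g x - f x)) = (M4 - m4) - s * (M2 - m2)
      + a\<^sup>2 * b\<^sup>2 * (moment g 0 - moment f 0)"
    unfolding w defs(2-) moment_def using fi[of 0] fi[of 2] fi[of 4] gi[of 0] gi[of 2] gi[of 4] by simp
  also have "\<dots> = (M4 - m4) - s * (M2 - m2)"
    by (simp add: moment_0_subsampling[OF f] moment_0_subsampling[OF g])
  finally have w_eq: "(LINT x|lborel. w x * (g x - f x)) = (M4 - m4) - s * (M2 - m2)" .
  \<comment> \<open>Where \<open>w\<close> is nonnegative, \<open>g\<close> equals the upper bound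
    \<open>std_normal_density\<close>. Strictly between \<open>b\<close> and \<open>a\<close> in
    absolute value, \<open>w\<close> is nonpositive and \<open>g\<close> equals the lower bound
    0.\<close>
  have w_nonneg: "0 \<le> w x * (g x - f x)" for x
  proof -
    have fx: "0 \<le> f x" "f x \<le> std_normal_density x"
      using f by (auto simp: subsampling_density_def)
    consider "\<bar>x\<bar> \<le> b" | "a \<le> \<bar>x\<bar>" | "b < \<bar>x\<bar>" "\<bar>x\<bar> < a" by linarith
    then show ?thesis
    proof cases
      case 1
      then have "g x = std_normal_density x"
        by (auto simp: g_def three_piece_density_def abs_le_iff split: split_indicator)
      moreover have "x\<^sup>2 \<le> b\<^sup>2" "x\<^sup>2 \<le> a\<^sup>2"
        using 1 b ba by (auto simp: abs_le_square_iff[symmetric])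
      ultimately show ?thesis using fx by (auto simp: w_def mult_nonpos_nonpos)
    next
      case 2
      then have "g x = std_normal_density x"
        by (auto simp: g_def three_piece_density_def abs_if split: if_splits)
      moreover have "b\<^sup>2 \<le> x\<^sup>2" "a\<^sup>2 \<le> x\<^sup>2"
        using 2 b ba by (auto simp: abs_le_square_iff[symmetric])
      ultimately show ?thesis using fx by (auto simp: w_def)
    next
      case 3
      then have "g x = 0" by (auto simp: g_def three_piece_density_def split: split_indicator)
      moreover have "b\<^sup>2 \<le> x\<^sup>2" "x\<^sup>2 \<le> a\<^sup>2"
        using 3 b ba by (auto simp: abs_le_square_iff[symmetric])
      ultimately show ?thesis using fx by (auto simp: w_def mult_nonpos_nonneg mult_nonneg_nonpos)
    qed
  qed
  have "0 \<le> (LINT x|lborel. w x * (g x - f x))"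
    using w_nonneg by (intro Bochner_Integration.integral_nonneg) auto
  then have gap: "0 \<le> (M4 - m4) - s * (M2 - m2)" unfolding w_eq .
  have M2: "0 < M2" and m2: "0 < m2" and \<Delta>: "0 < \<alpha> * M4 - M2\<^sup>2"
    using moment_2_pos[OF f \<alpha>] moment_2_pos[OF g \<alpha>] moment_Cauchy_Schwarz_strict[OF g \<alpha>]
    by (auto simp: defs)
  have st: "\<alpha> * s * M2 + \<alpha> * M4 = 3 * M2\<^sup>2" using stationary by (simp add: defs)
  \<comment> \<open>By stationarity the cubic bound for the criterion in \<open>m2\<close> has a double root at \<open>M2\<close>.\<close>
  define r where "r = m2 + 2 * M2 - \<alpha> * s"
  \<comment> \<open>\<open>r\<close> is the factor left after splitting off the double root.
    Stationarity turns \<open>M2 * r\<close> into a sum of two positive terms, one of them the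
    Cauchy-Schwarz gap of \<open>g\<close>.\<close>
  have "M2 * r = m2 * M2 + (\<alpha> * M4 - M2\<^sup>2)"
    using st by (simp add: r_def algebra_simps power2_eq_square)
  also have "\<dots> > 0" using M2 m2 \<Delta> by (simp add: add_pos_pos)
  finally have r: "0 < r" using M2 by (simp add: zero_less_mult_iff)
  \<comment> \<open>This polynomial identity holds without stationarity. Its right-hand side is a
    multiple of the stationarity defect and vanishes by \<open>st\<close>.\<close>
  have "M2 * (\<alpha> * M4 - M2\<^sup>2) - m2 * (\<alpha> * m4 - m2\<^sup>2)
      - ((m2 - M2)\<^sup>2 * r + \<alpha> * m2 * ((M4 - m4) - s * (M2 - m2)))
      = (M2 - m2) * (\<alpha> * s * M2 + \<alpha> * M4 - 3 * M2\<^sup>2)"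
    unfolding r_def by algebra
  then have diff: "M2 * (\<alpha> * M4 - M2\<^sup>2) - m2 * (\<alpha> * m4 - m2\<^sup>2)
      = (m2 - M2)\<^sup>2 * r + \<alpha> * m2 * ((M4 - m4) - s * (M2 - m2))"
    using st by simp
  have nn: "0 \<le> (m2 - M2)\<^sup>2 * r" "0 \<le> \<alpha> * m2 * ((M4 - m4) - s * (M2 - m2))"
    using r \<alpha> m2 gap by simp_all
  have det_g: "det (info_matrix (density lborel (\<lambda>x. ennreal (g x)))) = M2 * (\<alpha> * M4 - M2\<^sup>2)"
    using det_three_piece g by (simp add: g_def defs)
  have det_f: "det (info_matrix (density lborel (\<lambda>x. ennreal (f x)))) \<le> m2 * (\<alpha> * m4 - m2\<^sup>2)"
    using det_info_matrix_le[OF f \<alpha>] by (simp add: defs)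
  show "det (info_matrix (density lborel (\<lambda>x. ennreal (f x))))
      \<le> det (info_matrix (density lborel (\<lambda>x. ennreal (g x))))"
    using det_f det_g diff nn by linarith
  assume "det (info_matrix (density lborel (\<lambda>x. ennreal (f x))))
      = det (info_matrix (density lborel (\<lambda>x. ennreal (g x))))"
  \<comment> \<open>Equal determinants force both nonnegative remainders to vanish. The integral of
    \<open>w x * (g x - f x)\<close> is then 0, so \<open>f\<close> and \<open>g\<close> agree
    almost everywhere off the four roots of \<open>w\<close>.\<close>
  then have "\<alpha> * m2 * ((M4 - m4) - s * (M2 - m2)) = 0"
    using det_f det_g diff nn by linarith
  then have "(LINT x|lborel. w x * (g x - f x)) = 0"
    using \<alpha> m2 by (simp add: w_eq)
  then have "AE x in lborel. w x * (g x - f x) = 0"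
    using w_int w_nonneg by (subst (asm) integral_nonneg_eq_0_iff_AE) auto
  moreover have "AE x in lborel. x \<notin> {a, -a, b, -b}"
    by (intro AE_not_in finite_imp_null_set_lborel) simp
  ultimately show "AE x in lborel. f x = g x"
    by eventually_elim (auto simp: w_def power2_eq_iff)
qed

section \<open>Existence of a stationary three-piece density\<close>

lemma exists_stationary_three_piece:
  assumes "0 < \<alpha>" "\<alpha> < 1"
  obtains a b where "0 < b" "b < a" "central_prob b + 1 - central_prob a = \<alpha>"
    "\<alpha> * (a\<^sup>2 + b\<^sup>2) * moment (three_piece_density a b) 2 + \<alpha> * moment (three_piece_density a b) 4
      = 3 * (moment (three_piece_density a b) 2)\<^sup>2"
proof -
  have cont: "continuous_on {0..t} central_prob" for t
    by (rule continuous_on_subset[OF continuous_on_central_prob]) auto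
  \<comment> \<open>The starting point of the curve: the two tails beyond \<open>a0\<close> carry
    all the mass, so \<open>b = 0\<close>.\<close>
  obtain a0 where a0: "0 < a0" "central_prob a0 = 1 - \<alpha>"
  proof -
    \<comment> \<open>\<open>K\<close> makes the Chebyshev bound equal to \<open>\<alpha>\<close>,
      giving an upper end for the intermediate value theorem.\<close>
    define K where "K = 1 / sqrt \<alpha>"
    have "0 < K" "1 / K\<^sup>2 = \<alpha>" using assms by (auto simp: K_def field_simps)
    with central_prob_tail_bound[of K] have "1 - \<alpha> \<le> central_prob K" by simp
    with IVT'[of central_prob 0 "1 - \<alpha>" K] cont \<open>0 < K\<close> assms
    obtain x where x: "0 \<le> x" "central_prob x = 1 - \<alpha>" by (auto simp: central_prob_0)
    with assms central_prob_0 have "x \<noteq> 0" by auto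
    with x show thesis by (intro that[of x]) auto
  qed
  \<comment> \<open>The right end of the curve. The choice ensures
    \<open>3 < \<alpha> * A\<^sup>2\<close>, which makes \<open>H A\<close> positive below.\<close>
  define A where "A = max a0 (sqrt (3 / \<alpha>)) + 1"
  have A: "a0 < A" "3 < \<alpha> * A\<^sup>2"
  proof -
    show "a0 < A" by (simp add: A_def)
    have "sqrt (3 / \<alpha>) < A" by (simp add: A_def)
    then have "3 / \<alpha> < A\<^sup>2"
      using a0(1) \<open>a0 < A\<close> by (metis real_sqrt_less_iff real_sqrt_abs abs_of_pos less_trans)
    then show "3 < \<alpha> * A\<^sup>2" using assms by (simp add: field_simps)
  qed
  \<comment> \<open>The mass constraint makes \<open>b\<close> a continuous function of \<open>a\<close>.\<close>
  define ginv where "ginv = the_inv_into {0..A} central_prob"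
  have inj: "inj_on central_prob {0..A}"
    using central_prob_strict_mono by (intro linorder_inj_onI) (auto, fastforce)
  have ginv_cont: "continuous_on (central_prob ` {0..A}) ginv"
    unfolding ginv_def using inj by (intro continuous_on_inv cont) (auto simp: the_inv_into_f_f)
  have mono: "central_prob x \<le> central_prob y" if "0 \<le> x" "x \<le> y" for x y
    using central_prob_strict_mono[of x y] that by (cases "x = y") auto
  define \<beta> where "\<beta> a = ginv (\<alpha> - 1 + central_prob a)" for a
  have img: "\<alpha> - 1 + central_prob a \<in> central_prob ` {0..A}" if "a \<in> {a0..A}" for a
  proof -
    \<comment> \<open>The target value is at least 0 because
      \<open>central_prob a0 = 1 - \<alpha>\<close>, and below \<open>central_prob A\<close> because
      \<open>\<alpha> < 1\<close>.\<close>
    have "central_prob a0 \<le> central_prob a" "central_prob a \<le> central_prob A"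
      using that a0 mono[of a0 a] mono[of a A] by auto
    with IVT'[of central_prob 0 "\<alpha> - 1 + central_prob a" A] cont a0 A assms
    show ?thesis by (force simp: central_prob_0)
  qed
  have \<beta>: "\<beta> a \<in> {0..A}" "central_prob (\<beta> a) = \<alpha> - 1 + central_prob a" if "a \<in> {a0..A}" for a
    using img[OF that] inj unfolding \<beta>_def ginv_def
    by (auto simp: f_the_inv_into_f the_inv_into_f_f)
  have \<beta>_less: "\<beta> a < a" if "a \<in> {a0..A}" for a
    using \<beta>[OF that] mono[of a "\<beta> a"] that a0 assms by force
  have \<beta>_cont: "continuous_on {a0..A} \<beta>"
    unfolding \<beta>_def using img a0
    by (intro continuous_on_compose2[OF ginv_cont] continuous_intros
        continuous_on_subset[OF continuous_on_central_prob]) auto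
  have \<beta>_a0: "\<beta> a0 = 0"
  proof -
    have "central_prob (\<beta> a0) = central_prob 0" using \<beta>(2)[of a0] a0 A by (simp add: central_prob_0)
    then show ?thesis using inj \<beta>(1)[of a0] a0 A by (auto dest: inj_onD)
  qed
  let ?m = "\<lambda>k a. moment (three_piece_density a (\<beta> a)) k"
  \<comment> \<open>These closed forms of the moments make continuity in \<open>a\<close> visible;
    \<open>H\<close> is the stationarity defect.\<close>
  define M2 where "M2 a = \<alpha> - 2 * \<beta> a * std_normal_density (\<beta> a) + 2 * a * std_normal_density a" for a
  define M4 where "M4 a = 3 * M2 a - 2 * \<beta> a ^ 3 * std_normal_density (\<beta> a)
    + 2 * a ^ 3 * std_normal_density a" for a
  define H where "H a = \<alpha> * (a\<^sup>2 + (\<beta> a)\<^sup>2) * M2 a + \<alpha> * M4 a - 3 * (M2 a)\<^sup>2" for a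
  have M: "M2 a = ?m 2 a" "M4 a = ?m 4 a"
    and sub: "subsampling_density std_normal_density \<alpha> (three_piece_density a (\<beta> a))"
    if "a \<in> {a0..A}" for a
    using \<beta>[OF that] \<beta>_less[OF that]
    by (auto simp: M2_def M4_def moment_2_three_piece[where \<alpha> = \<alpha>] moment_4_three_piece[where \<alpha> = \<alpha>]
        intro!: subsampling_three_piece)
  have "continuous_on UNIV std_normal_density"
    using isCont_std_normal_density by (auto simp: continuous_on_eq_continuous_at)
  note phi_cont = continuous_on_compose2[OF this]
  have H_cont: "continuous_on {a0..A} H"
    unfolding H_def M4_def M2_def
    by (intro continuous_intros \<beta>_cont phi_cont[of "{a0..A}" "\<lambda>x. x"] phi_cont[of "{a0..A}" \<beta>]) auto
  have H_a0: "H a0 < 0"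
  proof -
    define q where "q = 2 * a0 * std_normal_density a0"
    have q: "0 < q" using a0 by (simp add: q_def normal_density_pos)
    \<comment> \<open>The tail probability at \<open>a0\<close> is \<open>\<alpha>\<close>, so this
      is the Mills bound multiplied by \<open>a0\<close>.\<close>
    have Mills: "a0\<^sup>2 * \<alpha> \<le> q"
      using mult_left_mono[OF Mills_ratio_le[OF a0(1)], of a0] a0
      by (simp add: q_def power2_eq_square mult_ac)
    have "M2 a0 = \<alpha> + q" by (simp add: M2_def \<beta>_a0 q_def)
    moreover have "M4 a0 = 3 * (\<alpha> + q) + a0\<^sup>2 * q"
      by (simp add: M4_def M2_def \<beta>_a0 q_def power2_eq_square power3_eq_cube)
    \<comment> \<open>The grouping isolates the factor \<open>a0\<^sup>2 * \<alpha> - q\<close>,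
      whose sign the Mills bound controls.\<close>
    ultimately have "H a0 = (a0\<^sup>2 * \<alpha> - q) * (\<alpha> + 2 * q) - 2 * \<alpha> * q - q\<^sup>2"
      by (simp add: H_def \<beta>_a0 power2_eq_square algebra_simps)
    moreover have "(a0\<^sup>2 * \<alpha> - q) * (\<alpha> + 2 * q) \<le> 0"
      using Mills q assms by (intro mult_nonpos_nonneg) auto
    moreover have "0 < 2 * \<alpha> * q" "0 < q\<^sup>2" using q assms by simp_all
    ultimately show ?thesis by linarith
  qed
  have H_A: "0 < H A"
  proof -
    have in_A: "A \<in> {a0..A}" using A by simp
    note subA = sub[OF in_A]
    have M2_A: "0 < M2 A" "M2 A \<le> 1"
      using moment_2_pos[OF subA] moment_2_le_1[OF subA] assms M[OF in_A] by auto
    \<comment> \<open>Since \<open>M2 A\<close> is at most 1, its square can be replaced by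
      \<open>M2 A\<close>, and the choice of \<open>A\<close> then dominates the factor 3.\<close>
    have "3 * (M2 A)\<^sup>2 \<le> 3 * M2 A" using M2_A by (simp add: power2_eq_square)
    also have "\<dots> < \<alpha> * A\<^sup>2 * M2 A" using A M2_A by simp
    also have "\<dots> \<le> \<alpha> * (A\<^sup>2 + (\<beta> A)\<^sup>2) * M2 A"
      using assms M2_A by (intro mult_right_mono mult_left_mono) auto
    finally have "3 * (M2 A)\<^sup>2 < \<alpha> * (A\<^sup>2 + (\<beta> A)\<^sup>2) * M2 A" .
    moreover have "0 \<le> \<alpha> * M4 A"
      using moment_Cauchy_Schwarz_strict[OF subA] assms M[OF in_A]
      by (metis less_eq_real_def less_le_trans zero_le_power2 le_less_trans)
    ultimately show ?thesis by (simp add: H_def)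
  qed
  obtain a where a: "a \<in> {a0..A}" "H a = 0"
    using IVT'[of H a0 0 A] H_cont H_a0 H_A A by force
  \<comment> \<open>The strict sign at \<open>a0\<close> excludes the degenerate end of the curve,
    which is what makes \<open>b\<close> positive.\<close>
  then have "a0 < a" using H_a0 by (cases "a = a0") auto
  then have "0 < central_prob (\<beta> a)"
    using central_prob_strict_mono[of a0 a] a0 \<beta>(2)[OF a(1)] by simp
  then have "0 < \<beta> a"
    using \<beta>(1)[OF a(1)] central_prob_0 by (cases "\<beta> a = 0") auto
  then show thesis
    using a \<beta>[OF a(1)] \<beta>_less[OF a(1)] M[OF a(1)]
    by (intro that[of "\<beta> a" a]) (auto simp: H_def)
qed

section \<open>Characterization of the D-optimal design\<close>

theorem theorem5p2:
  fixes \<alpha> :: real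
  assumes "0 < \<alpha>" and "\<alpha> < 1"
  shows "\<exists>a b :: real. a > b \<and> b > 0 \<and>
    (\<forall>\<xi>. D_optimal std_normal_density \<alpha> \<xi> \<longleftrightarrow>
       \<xi> = density lborel (\<lambda>x. ennreal
         (std_normal_density x * indicator ({..-a} \<union> {-b..b} \<union> {a..}) x)))"
proof -
  obtain a b where ab: "0 < b" "b < a" "central_prob b + 1 - central_prob a = \<alpha>"
    "\<alpha> * (a\<^sup>2 + b\<^sup>2) * moment (three_piece_density a b) 2 + \<alpha> * moment (three_piece_density a b) 4
      = 3 * (moment (three_piece_density a b) 2)\<^sup>2"
    using exists_stationary_three_piece[OF assms] by blast
  define D where "D f = density lborel (\<lambda>x. ennreal (f x))" for f :: "real \<Rightarrow> real"
  let ?g = "three_piece_density a b"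
  have g: "subsampling_density std_normal_density \<alpha> ?g"
    using ab by (intro subsampling_three_piece) auto
  have le: "det (info_matrix (D f)) \<le> det (info_matrix (D ?g))"
    if "subsampling_density std_normal_density \<alpha> f" for f
    unfolding D_def using three_piece_optimal(1)[OF assms(1) ab(1,2) that g ab(4)] .
  have eq: "D f = D ?g"
    if f: "subsampling_density std_normal_density \<alpha> f"
      and "det (info_matrix (D f)) = det (info_matrix (D ?g))" for f
  proof -
    have "AE x in lborel. f x = ?g x"
      using three_piece_optimal(2)[OF assms(1) ab(1,2) f g ab(4)] that(2) by (simp add: D_def)
    then show ?thesis unfolding D_def
      using f g by (intro density_cong) (auto simp: subsampling_density_def)
  qed
  have pos: "0 < det (info_matrix (D ?g))"
    unfolding D_def det_three_piece[OF g]
    using moment_2_pos[OF g] moment_Cauchy_Schwarz_strict[OF g] assms by simp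
  have design: "subsampling_design std_normal_density \<alpha> (D ?g)"
    using g by (auto simp: subsampling_design_def D_def)
  have "D_optimal std_normal_density \<alpha> \<xi> \<longleftrightarrow> \<xi> = D ?g" for \<xi>
  proof
    assume opt: "D_optimal std_normal_density \<alpha> \<xi>"
    then obtain f where f: "subsampling_density std_normal_density \<alpha> f" "\<xi> = D f"
      by (auto simp: D_optimal_def subsampling_design_def D_def)
    have "D_criterion (D ?g) \<le> D_criterion (D f)"
      using opt design f(2) by (auto simp: D_optimal_def)
    \<comment> \<open>The criterion of \<open>D ?g\<close> is finite by \<open>pos\<close>. A design
      at least as good therefore cannot have the value \<open>-\<infinity>\<close>, and the
      logarithms compare as the determinants do.\<close>
    then have "det (info_matrix (D ?g)) \<le> det (info_matrix (D f))"
      using pos by (auto simp: D_criterion_def split: if_splits)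
    with le[OF f(1)] eq[OF f(1)] f(2) show "\<xi> = D ?g" by simp
  next
    assume "\<xi> = D ?g"
    moreover have "D_criterion \<eta> \<le> D_criterion (D ?g)"
      if "subsampling_design std_normal_density \<alpha> \<eta>" for \<eta>
      using that le pos by (auto simp: subsampling_design_def D_criterion_def D_def[symmetric])
    ultimately show "D_optimal std_normal_density \<alpha> \<xi>"
      using design by (simp add: D_optimal_def)
  qed
  then show ?thesis
    using ab(1,2) unfolding D_def three_piece_density_def by blast
qed

end
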